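(* Let $\lambda>0$ and $0\le\mu<1$, and assume: (1) there is $C_m>0$ such that for every $\theta\in\mathbb{R}^{N_p}$, $\mathbb{E}_{X\sim\pi_\theta}\big[\|\nabla_\theta\log|\psi_\theta(X)|\|^4\big]\le C_m$ and $\mathbb{E}_{X\sim\pi_\theta}\big[E_{\mathrm{loc}}(\theta;X)^4\big]\le C_m$; (2) there is $C_g>0$ such that $\|g(\theta)-g(\theta')\|\le C_g\|\theta-\theta'\|$ for all $\theta,\theta'\in\mathbb{R}^{N_p}$; (3) the step sizes satisfy $0<\eta_k\le\eta_{k-1}$ for all $k\ge1$, and $0<\eta_0\le \frac{2\lambda(1-\mu)}{C_g}$. Let $\{\theta_k\}_{k\ge0}$ be generated, from given initial vectors $\theta_0,\Delta\theta_{-1}\in\mathbb{R}^{N_p}$, by the full-batch SPRING iteration $$\Delta\theta_k=(\lambda I+S(\theta_k))^{-1}\Big(\lambda\mu\,\Delta\theta_{k-1}-\tfrac12 g(\theta_k)\Big),\qquad \theta_{k+1}=\theta_k+\eta_k\Delta\theta_k,\qquad k\ge 0.$$ Then there exists $C>0$ such that for every $K\ge1$, $$\sum_{k=1}^{K}\eta_k\|g(\theta_k)\|^2\le C.$$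
   Context: Variational Monte Carlo setting. $N$ is the number of particles, $\Omega$ the single-particle configuration space (continuous, or discrete, in which case integrals over $\Omega^N$ denote sums), and $\mathscr{H}$ is a self-adjoint Hamiltonian acting on functions on $\Omega^N$. $\{\psi_\theta\}_{\theta\in\mathbb{R}^{N_p}}$ is a parametrized family of nonzero square-integrable real-valued wavefunctions $\psi_\theta:\Omega^N\to\mathbb{R}$. Define: - $\pi_\theta(x)=|\psi_\theta(x)|^2/\int|\psi_\theta|^2$, a probability density (or mass function) on $\Omega^N$; - local energy $E_{\mathrm{loc}}(\theta;x)=(\mathscr{H}\psi_\theta)(x)/\psi_\theta(x)$; - energy $L(\theta)=\langle\psi_\theta|\mathscr{H}|\psi_\theta\rangle/\langle\psi_\theta|\psi_\theta\rangle=\mathbb{E}_{X\sim\pi_\theta}[E_{\mathrm{loc}}(\theta;X)]$; - $\bar E(\theta;x)=E_{\mathrm{loc}}(\theta;x)-L(\theta)\in\mathbb{R}$ and $O(\theta;x)=\nabla_\theta\log|\psi_\theta(x)|-\mathbb{E}_{X\sim\pi_\theta}[\nabla_\theta\log|\psi_\theta(X)|]\in\mathbb{R}^{N_p}$; - gradient $g(\theta)=\nabla_\theta L(\theta)$, for which the standard VMC identity $g(\theta)=2\,\mathbb{E}_{X\sim\pi_\theta}[\bar E(\theta;X)O(\theta;X)]$ holds (standing assumption of the setting); - SR matrix $S(\theta)=\mathbb{E}_{X\sim\pi_\theta}[O(\theta;X)O(\theta;X)^\top]\in\mathbb{R}^{N_p\times N_p}$. $\|\cdot\|$ is the Euclidean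 norm. In the algorithm of interest $\Delta\theta_{-1}=0$. *)

theory Defs
  imports "HOL-Probability.Probability"
begin

definition config_space :: "'a measure \<Rightarrow> nat \<Rightarrow> (nat \<Rightarrow> 'a) measure" where
  "config_space M N = Pi\<^sub>M {..<N} (\<lambda>_. M)"

text \<open>
  In the three definitions below, elements of the real Hilbert space \<open>L\<^sup>2(Q)\<close> are represented by
  square-integrable functions, and equality in \<open>L\<^sup>2(Q)\<close> is equality almost everywhere. An unbounded
  operator is a pair of a domain \<open>D\<close> and a map \<open>H\<close>, whose values outside \<open>D\<close> are irrelevant.
\<close>

definition L2_fun :: "'c measure \<Rightarrow> ('c \<Rightarrow> real) set" where
  "L2_fun Q = {f \<in> borel_measurable Q. integrable Q (\<lambda>x. (f x)\<^sup>2)}"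

definition L2_inner :: "'c measure \<Rightarrow> ('c \<Rightarrow> real) \<Rightarrow> ('c \<Rightarrow> real) \<Rightarrow> real" where
  "L2_inner Q f h = (\<integral>x. f x * h x \<partial>Q)"

definition densely_defined_operator ::
  "'c measure \<Rightarrow> ('c \<Rightarrow> real) set \<Rightarrow> (('c \<Rightarrow> real) \<Rightarrow> ('c \<Rightarrow> real)) \<Rightarrow> bool" where
  "densely_defined_operator Q D H \<longleftrightarrow>
     D \<subseteq> L2_fun Q \<and> H ` D \<subseteq> L2_fun Q \<and>
     (\<forall>f\<in>D. \<forall>h\<in>L2_fun Q. (AE x in Q. f x = h x) \<longrightarrow> h \<in> D \<and> (AE x in Q. H f x = H h x)) \<and>
     (\<forall>f\<in>D. \<forall>h\<in>D. \<forall>a b. (\<lambda>x. a * f x + b * h x) \<in> D \<and>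
        (AE x in Q. H (\<lambda>x. a * f x + b * h x) x = a * H f x + b * H h x)) \<and>
     (\<forall>f\<in>L2_fun Q. \<forall>e>0. \<exists>h\<in>D. (\<integral>x. (f x - h x)\<^sup>2 \<partial>Q) < e)"

definition adjoint_graph ::
  "'c measure \<Rightarrow> ('c \<Rightarrow> real) set \<Rightarrow> (('c \<Rightarrow> real) \<Rightarrow> ('c \<Rightarrow> real)) \<Rightarrow>
     (('c \<Rightarrow> real) \<times> ('c \<Rightarrow> real)) set" where
  "adjoint_graph Q D H =
     {(f, u). f \<in> L2_fun Q \<and> u \<in> L2_fun Q \<and> (\<forall>h\<in>D. L2_inner Q f (H h) = L2_inner Q u h)}"

text \<open>
  Equality of graphs, hence also of domains: this is self-adjointness, not mere symmetry.
\<close>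

definition self_adjoint_operator ::
  "'c measure \<Rightarrow> ('c \<Rightarrow> real) set \<Rightarrow> (('c \<Rightarrow> real) \<Rightarrow> ('c \<Rightarrow> real)) \<Rightarrow> bool" where
  "self_adjoint_operator Q D H \<longleftrightarrow> densely_defined_operator Q D H \<and>
     adjoint_graph Q D H = {(f, u). f \<in> D \<and> u \<in> L2_fun Q \<and> (AE x in Q. u x = H f x)}"

definition gradient :: "('v::real_inner \<Rightarrow> real) \<Rightarrow> 'v \<Rightarrow> 'v" where
  "gradient f v = (THE d. GDERIV f v :> d)"

definition born_distribution :: "'c measure \<Rightarrow> ('v \<Rightarrow> 'c \<Rightarrow> real) \<Rightarrow> 'v \<Rightarrow> 'c measure" where
  "born_distribution Q \<psi> \<theta> =
     density Q (\<lambda>x. ennreal (\<bar>\<psi> \<theta> x\<bar>\<^sup>2 / (\<integral>y. \<bar>\<psi> \<theta> y\<bar>\<^sup>2 \<partial>Q)))"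

definition local_energy ::
  "(('c \<Rightarrow> real) \<Rightarrow> ('c \<Rightarrow> real)) \<Rightarrow> ('v \<Rightarrow> 'c \<Rightarrow> real) \<Rightarrow> 'v \<Rightarrow> 'c \<Rightarrow> real" where
  "local_energy H \<psi> \<theta> x = H (\<psi> \<theta>) x / \<psi> \<theta> x"

definition energy ::
  "'c measure \<Rightarrow> (('c \<Rightarrow> real) \<Rightarrow> ('c \<Rightarrow> real)) \<Rightarrow> ('v \<Rightarrow> 'c \<Rightarrow> real) \<Rightarrow> 'v \<Rightarrow> real" where
  "energy Q H \<psi> \<theta> = L2_inner Q (\<psi> \<theta>) (H (\<psi> \<theta>)) / L2_inner Q (\<psi> \<theta>) (\<psi> \<theta>)"

text \<open>
  The logarithm is undefined on the nodal set \<open>{x. \<psi> \<theta> x = 0}\<close>, which is a null set of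
  \<open>born_distribution Q \<psi> \<theta>\<close>; the value 0 there is a convention without effect on expectations.
\<close>

definition grad_log ::
  "('v::real_inner \<Rightarrow> 'c \<Rightarrow> real) \<Rightarrow> 'v \<Rightarrow> 'c \<Rightarrow> 'v" where
  "grad_log \<psi> \<theta> x = (if \<psi> \<theta> x = 0 then 0 else gradient (\<lambda>\<theta>'. ln \<bar>\<psi> \<theta>' x\<bar>) \<theta>)"

definition centered_energy ::
  "'c measure \<Rightarrow> (('c \<Rightarrow> real) \<Rightarrow> ('c \<Rightarrow> real)) \<Rightarrow> ('v \<Rightarrow> 'c \<Rightarrow> real) \<Rightarrow> 'v \<Rightarrow> 'c \<Rightarrow> real" where
  "centered_energy Q H \<psi> \<theta> x = local_energy H \<psi> \<theta> x - energy Q H \<psi> \<theta>"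

definition centered_grad_log ::
  "'c measure \<Rightarrow> (real^'p \<Rightarrow> 'c \<Rightarrow> real) \<Rightarrow> real^'p \<Rightarrow> 'c \<Rightarrow> real^'p" where
  "centered_grad_log Q \<psi> \<theta> x =
     grad_log \<psi> \<theta> x - (\<integral>y. grad_log \<psi> \<theta> y \<partial>born_distribution Q \<psi> \<theta>)"

definition energy_grad ::
  "'c measure \<Rightarrow> (('c \<Rightarrow> real) \<Rightarrow> ('c \<Rightarrow> real)) \<Rightarrow> (real^'p \<Rightarrow> 'c \<Rightarrow> real) \<Rightarrow>
     real^'p \<Rightarrow> real^'p" where
  "energy_grad Q H \<psi> \<theta> = gradient (energy Q H \<psi>) \<theta>"

definition SR_matrix ::
  "'c measure \<Rightarrow> (real^'p \<Rightarrow> 'c \<Rightarrow> real) \<Rightarrow> real^'p \<Rightarrow> real^'p^'p" where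
  "SR_matrix Q \<psi> \<theta> =
     (\<integral>x. (\<chi> i j. centered_grad_log Q \<psi> \<theta> x $ i * centered_grad_log Q \<psi> \<theta> x $ j)
        \<partial>born_distribution Q \<psi> \<theta>)"

text \<open>
  The measure \<open>M\<close> on the single-particle space is, for instance, \<open>lborel\<close> in the continuous case
  and \<open>count_space A\<close> with countable \<open>A\<close> in the discrete case. The last four assumptions make
  explicit what the definitions of \<open>\<nabla>\<^sub>\<theta> log \<bar>\<psi>\<^sub>\<theta>\<bar>\<close>, its expectation and \<open>\<nabla>L\<close> presuppose,
  together with the usual formula for the energy gradient.
\<close>

locale vmc_setting =
  fixes M :: "'a measure" and N :: nat
    and D :: "((nat \<Rightarrow> 'a) \<Rightarrow> real) set"
    and H :: "((nat \<Rightarrow> 'a) \<Rightarrow> real) \<Rightarrow> ((nat \<Rightarrow> 'a) \<Rightarrow> real)"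
    and \<psi> :: "real^'p \<Rightarrow> (nat \<Rightarrow> 'a) \<Rightarrow> real"
  assumes sigma_finite: "sigma_finite_measure M"
    and self_adjoint: "self_adjoint_operator (config_space M N) D H"
    and in_domain: "\<And>\<theta>. \<psi> \<theta> \<in> D"
    and nonzero: "\<And>\<theta>. \<not> (AE x in config_space M N. \<psi> \<theta> x = 0)"
    and log_differentiable: "\<And>\<theta>. AE x in born_distribution (config_space M N) \<psi> \<theta>.
           (\<lambda>\<theta>'. ln \<bar>\<psi> \<theta>' x\<bar>) differentiable (at \<theta>)"
    and grad_log_measurable: "\<And>\<theta>. grad_log \<psi> \<theta> \<in> borel_measurable (config_space M N)"
    and energy_differentiable: "\<And>\<theta>. energy (config_space M N) H \<psi> differentiable (at \<theta>)"
    and energy_grad_formula: "\<And>\<theta>. energy_grad (config_space M N) H \<psi> \<theta> =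
           2 *\<^sub>R (\<integral>x. centered_energy (config_space M N) H \<psi> \<theta> x *\<^sub>R
                    centered_grad_log (config_space M N) \<psi> \<theta> x
                  \<partial>born_distribution (config_space M N) \<psi> \<theta>)"
begin

lemma energy_eq_expectation:
  "energy (config_space M N) H \<psi> \<theta> =
     (\<integral>x. local_energy H \<psi> \<theta> x \<partial>born_distribution (config_space M N) \<psi> \<theta>)"
proof -
  let ?Q = "config_space M N"
  let ?Z = "\<integral>y. \<bar>\<psi> \<theta> y\<bar>\<^sup>2 \<partial>?Q"
  have "D \<subseteq> L2_fun ?Q" "H ` D \<subseteq> L2_fun ?Q"
    using self_adjoint unfolding self_adjoint_operator_def densely_defined_operator_def by auto
  then have m [measurable]: "\<psi> \<theta> \<in> borel_measurable ?Q" "H (\<psi> \<theta>) \<in> borel_measurable ?Q"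
    using in_domain[of \<theta>] by (auto simp: L2_fun_def)
  have m' [measurable]: "local_energy H \<psi> \<theta> \<in> borel_measurable ?Q"
    unfolding local_energy_def[abs_def] by measurable
  have "(\<integral>x. local_energy H \<psi> \<theta> x \<partial>born_distribution ?Q \<psi> \<theta>) =
          (\<integral>x. (\<bar>\<psi> \<theta> x\<bar>\<^sup>2 / ?Z) *\<^sub>R local_energy H \<psi> \<theta> x \<partial>?Q)"
    unfolding born_distribution_def by (rule integral_density) auto
  also have "\<dots> = (\<integral>x. \<psi> \<theta> x * H (\<psi> \<theta>) x / ?Z \<partial>?Q)"
    by (rule Bochner_Integration.integral_cong) (auto simp: local_energy_def power2_eq_square)
  also have "\<dots> = energy ?Q H \<psi> \<theta>"
    by (simp add: energy_def L2_inner_def power2_eq_square)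
  finally show ?thesis ..
qed

end

end

theory Submission
  imports Defs
begin

text \<open>
  With \<open>d\<^sub>k = \<Delta>\<theta>\<^sub>k\<close>, pairing the defining equation \<open>(\<lambda> + S\<^sub>k) d\<^sub>k = \<lambda>\<mu> d\<^sub>k\<^sub>-\<^sub>1 - g\<^sub>k / 2\<close> with \<open>d\<^sub>k\<close> and
  using \<open>S\<^sub>k \<ge> 0\<close> gives \<open>g\<^sub>k \<bullet> d\<^sub>k \<le> \<lambda>\<mu> \<parallel>d\<^sub>k\<^sub>-\<^sub>1\<parallel>\<^sup>2 - (2\<lambda> - \<lambda>\<mu>) \<parallel>d\<^sub>k\<parallel>\<^sup>2\<close>. Inserting this into the descent
  inequality for functions with Lipschitz gradient, and using the bound on \<open>\<eta>\<^sub>0\<close>, shows that the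
  Lyapunov function \<open>L(\<theta>\<^sub>k\<^sub>+\<^sub>1) + \<lambda> \<eta>\<^sub>k \<parallel>d\<^sub>k\<parallel>\<^sup>2\<close> decreases by at least \<open>\<lambda> (1 - \<mu>) \<eta>\<^sub>k \<parallel>d\<^sub>k\<parallel>\<^sup>2\<close> at each step.
  The moment bounds make \<open>L\<close> bounded below, so \<open>\<Sum> \<eta>\<^sub>k \<parallel>d\<^sub>k\<parallel>\<^sup>2 < \<infinity>\<close>; they also bound \<open>S\<close> uniformly, so
  the same equation controls \<open>\<parallel>g\<^sub>k\<parallel>\<close> by \<open>\<parallel>d\<^sub>k\<^sub>-\<^sub>1\<parallel>\<close> and \<open>\<parallel>d\<^sub>k\<parallel>\<close>.
\<close>

section \<open>Gradients and the descent inequality\<close>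

text \<open>\<open>gradient\<close> is a definite description, so it is meaningful only once
  existence and uniqueness are known. Existence is Riesz representation in finite dimension: the
  vector representing the derivative has coordinates \<open>D b\<close>.\<close>

lemma gderiv_gradient:
  fixes f :: "'v::euclidean_space \<Rightarrow> real"
  assumes "f differentiable (at v)"
  shows "GDERIV f v :> gradient f v"
proof -
  obtain D where D: "(f has_derivative D) (at v)"
    using assms unfolding differentiable_def by auto
  then interpret D: linear D by (rule has_derivative_linear)
  define d where "d = (\<Sum>b\<in>Basis. D b *\<^sub>R b)"
  have "D h = h \<bullet> d" for h
  proof -
    have "D h = D (\<Sum>b\<in>Basis. (h \<bullet> b) *\<^sub>R b)"
      by (simp add: euclidean_representation)
    also have "\<dots> = h \<bullet> d"
      by (simp add: D.sum D.scale d_def inner_sum_right mult.commute)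
    finally show ?thesis .
  qed
  then have "D = (\<lambda>h. h \<bullet> d)" by auto
  then have G: "GDERIV f v :> d" using D by (simp add: gderiv_def)
  have uniq: "e = d" if "GDERIV f v :> e" for e
  proof -
    have "(\<lambda>h. h \<bullet> e) = (\<lambda>h. h \<bullet> d)"
      using that G unfolding gderiv_def by (rule has_derivative_unique)
    then have "h \<bullet> (e - d) = 0" for h by (metis inner_diff_right right_minus_eq)
    then show ?thesis by (metis inner_eq_zero_iff right_minus_eq)
  qed
  show ?thesis unfolding gradient_def
    by (rule theI[where P = "\<lambda>d. GDERIV f v :> d", OF G uniq])
qed

text \<open>Along the segment from \<open>x\<close> to \<open>x + d\<close>, subtract from
  \<open>f\<close> its quadratic upper model. The difference \<open>\<phi>\<close> has nonpositive
  derivative for \<open>t \<ge> 0\<close>, by Cauchy-Schwarz and the Lipschitz bound, so comparing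
  \<open>t = 0\<close> with \<open>t = 1\<close> suffices.\<close>

lemma lipschitz_gradient_descent:
  fixes f :: "'v::real_inner \<Rightarrow> real"
  assumes G: "\<And>x. GDERIV f x :> g x"
    and lip: "\<And>x y. norm (g x - g y) \<le> C * norm (x - y)"
  shows "f (x + d) \<le> f x + g x \<bullet> d + C / 2 * (norm d)\<^sup>2"
proof -
  define \<phi> where "\<phi> t = f (x + t *\<^sub>R d) - t * (g x \<bullet> d) - C / 2 * t\<^sup>2 * (norm d)\<^sup>2" for t :: real
  have "(\<phi> has_real_derivative (g (x + t *\<^sub>R d) \<bullet> d - g x \<bullet> d - C * t * (norm d)\<^sup>2)) (at t)" for t
  proof -
    have "((\<lambda>t. f (x + t *\<^sub>R d)) has_derivative (\<lambda>h. (h *\<^sub>R d) \<bullet> g (x + t *\<^sub>R d))) (at t)"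
      by (rule has_derivative_compose[where g = f, OF _ G[unfolded gderiv_def]])
         (auto intro!: derivative_eq_intros)
    then have "((\<lambda>t. f (x + t *\<^sub>R d)) has_real_derivative (g (x + t *\<^sub>R d) \<bullet> d)) (at t)"
      by (rule has_derivative_imp_has_field_derivative) (simp add: inner_commute)
    then show ?thesis unfolding \<phi>_def
      by (auto intro!: derivative_eq_intros simp: field_simps)
  qed
  moreover have "g (x + t *\<^sub>R d) \<bullet> d - g x \<bullet> d - C * t * (norm d)\<^sup>2 \<le> 0" if "t \<ge> 0" for t
  proof -
    have "g (x + t *\<^sub>R d) \<bullet> d - g x \<bullet> d \<le> norm (g (x + t *\<^sub>R d) - g x) * norm d"
      by (metis inner_diff_left norm_cauchy_schwarz)
    also have "\<dots> \<le> (C * norm (x + t *\<^sub>R d - x)) * norm d"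
      by (intro mult_right_mono lip) auto
    also have "\<dots> = C * t * (norm d)\<^sup>2"
      using that by (simp add: power2_eq_square)
    finally show ?thesis by simp
  qed
  ultimately have "\<phi> 1 \<le> \<phi> 0"
    by (intro DERIV_nonpos_imp_nonincreasing[of 0 1 \<phi>] exI conjI) auto
  then show ?thesis by (simp add: \<phi>_def)
qed

section \<open>Lyapunov analysis of damped momentum descent\<close>

text \<open>The vector \<open>u\<close> stands for the matrix applied to \<open>d\<close>, and
  \<open>e\<close> for the previous direction. Positive semidefiniteness enters only as the sign of
  \<open>d \<bullet> u\<close>, so no matrix has to appear.\<close>

lemma damped_momentum_lyapunov_step:
  fixes f :: "'v::real_inner \<Rightarrow> real"
  assumes "\<And>x. GDERIV f x :> g x"
    and "\<And>x y. norm (g x - g y) \<le> C * norm (x - y)"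
    and "lam > 0" "0 \<le> \<mu>" "C > 0" "0 < s" "s \<le> 2 * lam * (1 - \<mu>) / C"
    and eq: "lam *\<^sub>R d + u = (lam * \<mu>) *\<^sub>R e - (1 / 2) *\<^sub>R g x"
    and psd: "d \<bullet> u \<ge> 0"
  shows "f (x + s *\<^sub>R d) + lam * s * (norm d)\<^sup>2 \<le> f x + lam * \<mu> * s * (norm e)\<^sup>2"
proof -
  have "(lam *\<^sub>R d + u) \<bullet> d = ((lam * \<mu>) *\<^sub>R e - (1 / 2) *\<^sub>R g x) \<bullet> d" using eq by simp
  then have "lam * (d \<bullet> d) + d \<bullet> u = lam * \<mu> * (e \<bullet> d) - (g x \<bullet> d) / 2"
    by (simp add: inner_add_right inner_diff_right inner_commute)
  then have "g x \<bullet> d = 2 * (lam * \<mu>) * (e \<bullet> d) - 2 * lam * (norm d)\<^sup>2 - 2 * (d \<bullet> u)"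
    by (simp add: power2_norm_eq_inner field_simps)
  moreover have "(lam * \<mu>) * (2 * (e \<bullet> d)) \<le> (lam * \<mu>) * ((norm e)\<^sup>2 + (norm d)\<^sup>2)"
  proof (rule mult_left_mono)
    show "2 * (e \<bullet> d) \<le> (norm e)\<^sup>2 + (norm d)\<^sup>2"
      using inner_ge_zero[of "e - d"]
      by (simp add: inner_diff_left inner_diff_right power2_norm_eq_inner inner_commute)
  qed (use assms in auto)
  ultimately have gd: "g x \<bullet> d \<le> lam * \<mu> * (norm e)\<^sup>2 - (2 * lam - lam * \<mu>) * (norm d)\<^sup>2"
    using psd by (simp add: algebra_simps)
  \<comment> \<open>The step size bound is tuned to this: the curvature term costs at most lam * (1
    - \<mu>) times the squared norm of \<open>d\<close>, which turns the coefficient -(2 * lam - lam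
    * \<mu>) from \<open>gd\<close> into exactly -lam.\<close>
  have "C * s \<le> 2 * lam * (1 - \<mu>)"
    using assms by (simp add: field_simps)
  then have cs: "C / 2 * s * (norm d)\<^sup>2 \<le> lam * (1 - \<mu>) * (norm d)\<^sup>2"
    by (intro mult_right_mono) auto
  have "f (x + s *\<^sub>R d) \<le> f x + g x \<bullet> (s *\<^sub>R d) + C / 2 * (norm (s *\<^sub>R d))\<^sup>2"
    by (rule lipschitz_gradient_descent) fact+
  also have "\<dots> = f x + s * (g x \<bullet> d + C / 2 * s * (norm d)\<^sup>2)"
    by (simp add: power_mult_distrib power2_eq_square algebra_simps)
  also have "\<dots> \<le> f x + s * (lam * \<mu> * (norm e)\<^sup>2 - lam * (norm d)\<^sup>2)"
    using gd cs \<open>0 < s\<close> by (intro add_left_mono mult_left_mono) (auto simp: algebra_simps)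
  finally show ?thesis by (simp add: algebra_simps)
qed

text \<open>The equation is imposed at indices \<open>Suc k\<close>, where the previous direction is
  the iterate \<open>d k\<close>. The effect of the very first step is contained in the constant
  \<open>W 0\<close>.\<close>

lemma damped_momentum_gradient_sum_bounded:
  fixes f :: "'v::real_inner \<Rightarrow> real" and x d u :: "nat \<Rightarrow> 'v"
  assumes G: "\<And>v. GDERIV f v :> g v"
    and lip: "\<And>v w. norm (g v - g w) \<le> C * norm (v - w)"
    and lower: "\<And>v. m \<le> f v"
    and pos: "lam > 0" "0 \<le> \<mu>" "\<mu> < 1" "C > 0"
    and s_pos: "\<And>k. 0 < s k" and s_dec: "\<And>k. s (Suc k) \<le> s k"
    and s_0: "s 0 \<le> 2 * lam * (1 - \<mu>) / C"
    and eq: "\<And>k. lam *\<^sub>R d (Suc k) + u (Suc k) = (lam * \<mu>) *\<^sub>R d k - (1 / 2) *\<^sub>R g (x (Suc k))"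
    and psd: "\<And>k. d k \<bullet> u k \<ge> 0"
    and u_le: "\<And>k. norm (u k) \<le> B * norm (d k)"
    and upd: "\<And>k. x (Suc k) = x k + s k *\<^sub>R d k"
  shows "\<exists>C'>0. \<forall>K. (\<Sum>k=1..K. s k * (norm (g (x k)))\<^sup>2) \<le> C'"
proof -
  define a where "a k = s k * (norm (d k))\<^sup>2" for k
  define W where "W k = f (x (Suc k)) + lam * a k" for k
  have a0: "a k \<ge> 0" for k using s_pos[of k] by (simp add: a_def)
  have s_le: "s k \<le> s 0" for k
    using s_dec by (intro decseqD[of s]) (auto simp: decseq_Suc_iff)
  have step: "W (Suc k) \<le> W k - lam * (1 - \<mu>) * a k" for k
  proof -
    have "f (x (Suc k) + s (Suc k) *\<^sub>R d (Suc k)) + lam * s (Suc k) * (norm (d (Suc k)))\<^sup>2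
        \<le> f (x (Suc k)) + lam * \<mu> * s (Suc k) * (norm (d k))\<^sup>2"
      using s_le[of "Suc k"] s_0
      by (intro damped_momentum_lyapunov_step[OF G lip pos(1,2,4) s_pos _ eq psd]) auto
    \<comment> \<open>Nonincreasing step sizes let the momentum term be paid from the stored
      \<open>lam * a k\<close>. It uses up at most the fraction \<mu>, and the rest is the
      decrease.\<close>
    moreover have "lam * \<mu> * (s (Suc k) * (norm (d k))\<^sup>2) \<le> lam * \<mu> * (s k * (norm (d k))\<^sup>2)"
      using pos s_dec[of k] by (intro mult_left_mono mult_right_mono) auto
    ultimately show ?thesis
      using upd[of "Suc k"] by (simp add: W_def a_def algebra_simps)
  qed
  have sum_W: "lam * (1 - \<mu>) * (\<Sum>k<K. a k) \<le> W 0 - W K" for K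
  proof (induction K)
    case (Suc K)
    then show ?case using step[of K] by (simp add: algebra_simps)
  qed simp
  define T where "T = (W 0 - m) / (lam * (1 - \<mu>))"
  have sum_a: "(\<Sum>k<K. a k) \<le> T" for K
  proof -
    have "m \<le> W K"
      using lower[of "x (Suc K)"] a0[of K] pos by (simp add: W_def add_increasing2)
    then have "lam * (1 - \<mu>) * (\<Sum>k<K. a k) \<le> W 0 - m" using sum_W[of K] by simp
    then show ?thesis using pos by (simp add: T_def field_simps)
  qed
  \<comment> \<open>The sum of the two coefficients in \<open>grad_le\<close>. The 8 is 4 from the
    factor 2 in front of the norm, times 2 from splitting a squared sum. The absolute value is taken
    because no sign of \<open>B\<close> is assumed.\<close>
  define E where "E = 8 * (lam * \<mu>)\<^sup>2 + 8 * (lam + \<bar>B\<bar>)\<^sup>2"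
  have T0: "T \<ge> 0" using sum_a[of 0] by simp
  have E0: "E \<ge> 0" by (simp add: E_def)
  have grad_le: "s (Suc k) * (norm (g (x (Suc k))))\<^sup>2
      \<le> 8 * (lam * \<mu>)\<^sup>2 * a k + 8 * (lam + \<bar>B\<bar>)\<^sup>2 * a (Suc k)" for k
  proof -
    let ?p = "lam * \<mu> * norm (d k)" and ?q = "(lam + \<bar>B\<bar>) * norm (d (Suc k))"
    have "g (x (Suc k)) = 2 *\<^sub>R ((lam * \<mu>) *\<^sub>R d k - (lam *\<^sub>R d (Suc k) + u (Suc k)))"
      unfolding eq[of k] by simp
    then have "norm (g (x (Suc k))) = 2 * norm ((lam * \<mu>) *\<^sub>R d k - (lam *\<^sub>R d (Suc k) + u (Suc k)))"
      by simp
    also have "\<dots> \<le> 2 * (norm ((lam * \<mu>) *\<^sub>R d k) + (norm (lam *\<^sub>R d (Suc k)) + norm (u (Suc k))))"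
      by (intro mult_left_mono order_trans[OF norm_triangle_ineq4] add_left_mono norm_triangle_ineq) auto
    also have "\<dots> \<le> 2 * (?p + ?q)"
    proof -
      have "norm (u (Suc k)) \<le> \<bar>B\<bar> * norm (d (Suc k))"
        by (rule order_trans[OF u_le]) (auto intro: mult_right_mono)
      then show ?thesis using pos by (simp add: algebra_simps)
    qed
    finally have "(norm (g (x (Suc k))))\<^sup>2 \<le> (2 * (?p + ?q))\<^sup>2"
      by (intro power_mono) auto
    also have "\<dots> \<le> 8 * ?p\<^sup>2 + 8 * ?q\<^sup>2"
      using zero_le_power2[of "?p - ?q"] by (simp add: power2_eq_square algebra_simps)
    finally have "s (Suc k) * (norm (g (x (Suc k))))\<^sup>2 \<le> s (Suc k) * (8 * ?p\<^sup>2 + 8 * ?q\<^sup>2)"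
      using s_pos[of "Suc k"] by (intro mult_left_mono) auto
    also have "\<dots> = s (Suc k) * (8 * ?p\<^sup>2) + 8 * (lam + \<bar>B\<bar>)\<^sup>2 * a (Suc k)"
      unfolding a_def power_mult_distrib by (simp add: algebra_simps)
    \<comment> \<open>Monotonicity again: the weight must carry the index of \<open>d k\<close> to
      produce \<open>a k\<close>.\<close>
    also have "s (Suc k) * (8 * ?p\<^sup>2) \<le> s k * (8 * ?p\<^sup>2)"
      using s_dec[of k] by (intro mult_right_mono) auto
    also have "\<dots> = 8 * (lam * \<mu>)\<^sup>2 * a k"
      by (simp add: a_def power_mult_distrib algebra_simps)
    finally show ?thesis by simp
  qed
  have "(\<Sum>k=1..K. s k * (norm (g (x k)))\<^sup>2) \<le> E * T" for K
  proof -
    have "(\<Sum>k=1..K. s k * (norm (g (x k)))\<^sup>2) = (\<Sum>k<K. s (Suc k) * (norm (g (x (Suc k))))\<^sup>2)"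
      by (rule sum.reindex_bij_witness[of _ Suc "\<lambda>k. k - 1"]) auto
    also have "\<dots> \<le> (\<Sum>k<K. 8 * (lam * \<mu>)\<^sup>2 * a k + 8 * (lam + \<bar>B\<bar>)\<^sup>2 * a (Suc k))"
      by (intro sum_mono grad_le)
    also have "\<dots> = 8 * (lam * \<mu>)\<^sup>2 * (\<Sum>k<K. a k) + 8 * (lam + \<bar>B\<bar>)\<^sup>2 * (\<Sum>k<K. a (Suc k))"
      by (simp add: sum.distrib sum_distrib_left)
    also have "\<dots> \<le> 8 * (lam * \<mu>)\<^sup>2 * T + 8 * (lam + \<bar>B\<bar>)\<^sup>2 * T"
    proof (intro add_mono mult_left_mono sum_a)
      have "(\<Sum>k<K. a (Suc k)) \<le> (\<Sum>k<Suc K. a k)"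
        using a0[of 0] by (simp add: sum.lessThan_Suc_shift del: sum.lessThan_Suc)
      then show "(\<Sum>k<K. a (Suc k)) \<le> T" using sum_a[of "Suc K"] by linarith
    qed auto
    finally show ?thesis by (simp add: E_def algebra_simps)
  qed
  \<comment> \<open>\<open>E * T\<close> is only known to be nonnegative; adding 1 makes the
    constant strictly positive.\<close>
  then have "\<forall>K. (\<Sum>k=1..K. s k * (norm (g (x k)))\<^sup>2) \<le> E * T + 1"
    by (meson add_increasing2 order_refl order_trans zero_le_one)
  moreover have "E * T + 1 > 0" using T0 E0 by (simp add: add_nonneg_pos)
  ultimately show ?thesis by blast
qed

section \<open>Moment bounds and second moment matrices\<close>

lemma integrable_euclidean:
  fixes f :: "'c \<Rightarrow> 'v::euclidean_space"
  assumes "\<And>b. b \<in> Basis \<Longrightarrow> integrable P (\<lambda>x. f x \<bullet> b)"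
  shows "integrable P f"
proof -
  have "integrable P (\<lambda>x. \<Sum>b\<in>Basis. (f x \<bullet> b) *\<^sub>R b)"
    using assms by (intro Bochner_Integration.integrable_sum integrable_scaleR_left) auto
  then show ?thesis by (simp add: euclidean_representation)
qed

lemma power_le_1_plus_power4:
  fixes t :: real
  assumes "0 \<le> t" "n \<le> 4"
  shows "t ^ n \<le> 1 + t ^ 4"
proof (cases "t \<le> 1")
  case True
  then have "t ^ n \<le> 1" using assms by (simp add: power_le_one)
  then show ?thesis using assms zero_le_power[of t 4] by linarith
next
  case False
  then have "t ^ n \<le> t ^ 4" using assms by (intro power_increasing) auto
  then show ?thesis by simp
qed

context prob_space
begin

text \<open>The pointwise bound t^n <= 1 + t^4 takes the place of Jensen's inequality. The result is
  cruder, but it depends on \<open>c\<close> alone.\<close>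

lemma moments_le_fourth_moment:
  fixes X :: "'a \<Rightarrow> 'v::{banach, second_countable_topology}"
  assumes X: "X \<in> borel_measurable M"
    and int: "integrable M (\<lambda>x. norm (X x) ^ 4)"
    and le: "(\<integral>x. norm (X x) ^ 4 \<partial>M) \<le> c" and n: "n \<le> 4"
  shows "integrable M (\<lambda>x. norm (X x) ^ n)" "(\<integral>x. norm (X x) ^ n \<partial>M) \<le> 1 + c"
proof -
  have b: "norm (X x) ^ n \<le> 1 + norm (X x) ^ 4" for x
    using n by (intro power_le_1_plus_power4) auto
  have int1: "integrable M (\<lambda>x. 1 + norm (X x) ^ 4)" using int by simp
  show intn: "integrable M (\<lambda>x. norm (X x) ^ n)"
    by (rule Bochner_Integration.integrable_bound[OF int1])
       (use X b in \<open>auto intro!: AE_I2 simp: abs_of_nonneg add_nonneg_nonneg\<close>)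
  have "(\<integral>x. norm (X x) ^ n \<partial>M) \<le> (\<integral>x. 1 + norm (X x) ^ 4 \<partial>M)"
    by (rule integral_mono[OF intn int1 b])
  also have "\<dots> = 1 + (\<integral>x. norm (X x) ^ 4 \<partial>M)"
    using int by (simp add: prob_space)
  finally show "(\<integral>x. norm (X x) ^ n \<partial>M) \<le> 1 + c" using le by simp
qed

lemma centered_second_moment_le:
  fixes X :: "'a \<Rightarrow> 'v::euclidean_space"
  assumes X [measurable]: "X \<in> borel_measurable M"
    and int: "integrable M (\<lambda>x. norm (X x) ^ 4)"
    and le: "(\<integral>x. norm (X x) ^ 4 \<partial>M) \<le> c"
  shows "integrable M (\<lambda>x. (norm (X x - expectation X))\<^sup>2)"
    and "(\<integral>x. (norm (X x - expectation X))\<^sup>2 \<partial>M) \<le> 2 * (1 + c) + 2 * (1 + c)\<^sup>2"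
proof -
  note m1 = moments_le_fourth_moment[OF X int le, of 1, simplified]
  note m2 = moments_le_fourth_moment[OF X int le, of 2, simplified]
  have "norm (expectation X) \<le> 1 + c"
    by (rule order_trans[OF integral_norm_bound m1(2)])
  then have mean: "(norm (expectation X))\<^sup>2 \<le> (1 + c)\<^sup>2"
    by (intro power_mono) auto
  have b: "(norm (X x - expectation X))\<^sup>2 \<le> 2 * (norm (X x))\<^sup>2 + 2 * (norm (expectation X))\<^sup>2" for x
  proof -
    have "(norm (X x - expectation X))\<^sup>2 \<le> (norm (X x) + norm (expectation X))\<^sup>2"
      by (intro power_mono norm_triangle_ineq4) auto
    also have "\<dots> \<le> 2 * (norm (X x))\<^sup>2 + 2 * (norm (expectation X))\<^sup>2"
      using zero_le_power2[of "norm (X x) - norm (expectation X)"]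
      by (simp add: power2_eq_square algebra_simps)
    finally show ?thesis .
  qed
  have int2: "integrable M (\<lambda>x. 2 * (norm (X x))\<^sup>2 + 2 * (norm (expectation X))\<^sup>2)"
    using m2(1) by simp
  show i: "integrable M (\<lambda>x. (norm (X x - expectation X))\<^sup>2)"
    by (rule Bochner_Integration.integrable_bound[OF int2])
       (use b in \<open>auto intro!: AE_I2 simp: abs_of_nonneg add_nonneg_nonneg\<close>)
  have "(\<integral>x. (norm (X x - expectation X))\<^sup>2 \<partial>M)
      \<le> (\<integral>x. 2 * (norm (X x))\<^sup>2 + 2 * (norm (expectation X))\<^sup>2 \<partial>M)"
    by (rule integral_mono[OF i int2 b])
  also have "\<dots> = 2 * (\<integral>x. (norm (X x))\<^sup>2 \<partial>M) + 2 * (norm (expectation X))\<^sup>2"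
    using m2(1) by (simp add: prob_space)
  also have "\<dots> \<le> 2 * (1 + c) + 2 * (1 + c)\<^sup>2"
    using m2(2) mean by simp
  finally show "(\<integral>x. (norm (X x - expectation X))\<^sup>2 \<partial>M) \<le> 2 * (1 + c) + 2 * (1 + c)\<^sup>2" .
qed

end

text \<open>Everything follows from the bilinear form \<open>form\<close>: the choice w = v gives a
  square under the integral, and w = S v together with Cauchy-Schwarz gives the norm bound.\<close>

lemma second_moment_matrix:
  fixes X :: "'c \<Rightarrow> real^'p"
  assumes X [measurable]: "X \<in> borel_measurable P"
    and int: "integrable P (\<lambda>x. (norm (X x))\<^sup>2)"
    and le: "(\<integral>x. (norm (X x))\<^sup>2 \<partial>P) \<le> B"
  defines "S \<equiv> (\<integral>x. (\<chi> i j. X x $ i * X x $ j) \<partial>P)"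
  shows "v \<bullet> (S *v v) \<ge> 0" and "norm (S *v v) \<le> B * norm v"
proof -
  have prod_le: "\<bar>(w \<bullet> X x) * (v \<bullet> X x)\<bar> \<le> norm w * norm v * (norm (X x))\<^sup>2" for w v x
  proof -
    have "\<bar>w \<bullet> X x\<bar> * \<bar>v \<bullet> X x\<bar> \<le> (norm w * norm (X x)) * (norm v * norm (X x))"
      by (intro mult_mono Cauchy_Schwarz_ineq2) auto
    then show ?thesis by (simp add: abs_mult power2_eq_square algebra_simps)
  qed
  have int_prod: "integrable P (\<lambda>x. (w \<bullet> X x) * (v \<bullet> X x))" for w v
    by (rule Bochner_Integration.integrable_bound[OF integrable_mult_right[OF int, of "norm w * norm v"]])
       (use prod_le in \<open>auto intro!: AE_I2\<close>)
  \<comment> \<open>Integrability of the matrix as a whole permits pulling linear functionals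
    through the Bochner integral; each entry is the product in \<open>int_prod\<close> for two
    coordinate axes.\<close>
  have mat: "integrable P (\<lambda>x. (\<chi> i j. X x $ i * X x $ j) :: real^'p^'p)"
  proof (rule integrable_euclidean)
    fix b :: "real^'p^'p" assume "b \<in> Basis"
    then obtain i j where b: "b = axis i (axis j 1)"
      unfolding Basis_vec_def by auto
    have "integrable P (\<lambda>x. (axis i 1 \<bullet> X x) * (axis j 1 \<bullet> X x))" by (rule int_prod)
    then show "integrable P (\<lambda>x. ((\<chi> i j. X x $ i * X x $ j) :: real^'p^'p) \<bullet> b)"
      by (simp add: b inner_axis inner_axis')
  qed
  have form: "w \<bullet> (S *v v) = (\<integral>x. (w \<bullet> X x) * (v \<bullet> X x) \<partial>P)" for w v
  proof -
    have "linear (\<lambda>A::real^'p^'p. w \<bullet> (A *v v))"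
      by (rule linearI) (simp_all add: matrix_vector_mult_add_rdistrib inner_add_right
        scaleR_matrix_vector_assoc[symmetric])
    then have "bounded_linear (\<lambda>A::real^'p^'p. w \<bullet> (A *v v))"
      by (rule linear_conv_bounded_linear[THEN iffD1])
    from integral_bounded_linear[OF this mat]
    have "w \<bullet> (S *v v) = (\<integral>x. w \<bullet> ((\<chi> i j. X x $ i * X x $ j) *v v) \<partial>P)"
      by (simp add: S_def)
    also have "\<dots> = (\<integral>x. (w \<bullet> X x) * (v \<bullet> X x) \<partial>P)"
      by (simp add: inner_vec_def matrix_vector_mult_def sum_product sum_distrib_left mult.assoc
        mult.left_commute mult.commute)
    finally show ?thesis .
  qed
  show "v \<bullet> (S *v v) \<ge> 0"
    unfolding form by (rule Bochner_Integration.integral_nonneg) simp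
  let ?w = "S *v v"
  have "(norm ?w)\<^sup>2 = (\<integral>x. (?w \<bullet> X x) * (v \<bullet> X x) \<partial>P)"
    unfolding form[symmetric] by (simp add: power2_norm_eq_inner)
  also have "\<dots> \<le> (\<integral>x. norm ?w * norm v * (norm (X x))\<^sup>2 \<partial>P)"
    using int by (intro integral_mono int_prod order_trans[OF abs_ge_self prod_le]) auto
  also have "\<dots> = norm ?w * norm v * (\<integral>x. (norm (X x))\<^sup>2 \<partial>P)" by simp
  also have "\<dots> \<le> norm ?w * norm v * B"
    by (intro mult_left_mono le) auto
  finally have "norm ?w * norm ?w \<le> norm ?w * (B * norm v)"
    by (simp add: power2_eq_square algebra_simps)
  \<comment> \<open>Needed when S v = 0, where a factor \<open>norm ?w\<close> cannot be
    cancelled.\<close>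
  moreover have "0 \<le> B * norm v"
    by (intro mult_nonneg_nonneg order_trans[OF _ le] Bochner_Integration.integral_nonneg) auto
  ultimately show "norm ?w \<le> B * norm v"
    by (cases "norm ?w = 0") (auto simp: mult_le_cancel_left)
qed

text \<open>\<open>matrix_inv\<close> is a choice that is an inverse only for invertible matrices.
  Positive semidefiniteness and lam > 0 make the kernel of the shifted matrix trivial, hence the
  matrix invertible.\<close>

lemma matrix_inv_shifted_mult:
  fixes S :: "real^'p^'p"
  assumes "lam > 0" and psd: "\<And>v. v \<bullet> (S *v v) \<ge> 0"
    and d: "d = matrix_inv (lam *\<^sub>R mat 1 + S) *v r"
  shows "lam *\<^sub>R d + S *v d = r"
proof -
  let ?A = "lam *\<^sub>R mat 1 + S"
  have A: "?A *v v = lam *\<^sub>R v + S *v v" for v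
    by (simp add: matrix_vector_mult_add_rdistrib scaleR_matrix_vector_assoc[symmetric])
  have "v = 0" if "?A *v v = 0" for v
  proof -
    have "0 = v \<bullet> (?A *v v)" using that by simp
    also have "\<dots> = lam * (v \<bullet> v) + v \<bullet> (S *v v)" by (simp add: A inner_add_right)
    finally have "lam * (v \<bullet> v) \<le> 0" using psd[of v] by linarith
    then have "v \<bullet> v \<le> 0" using \<open>lam > 0\<close> by (simp add: mult_le_0_iff)
    then show ?thesis by (metis inner_eq_zero_iff inner_ge_zero order_antisym)
  qed
  then have "invertible ?A"
    by (simp add: invertible_left_inverse matrix_left_invertible_ker)
  then have "?A ** matrix_inv ?A = mat 1"
    unfolding invertible_def matrix_inv_def by (rule someI_ex[THEN conjunct1])
  then have "?A *v d = r" by (simp add: d matrix_vector_mul_assoc)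
  then show ?thesis by (simp add: A)
qed

section \<open>Bounds for the energy and the SR matrix\<close>

context vmc_setting
begin

lemma wavefunction_L2:
  "\<psi> \<theta> \<in> borel_measurable (config_space M N)"
  "H (\<psi> \<theta>) \<in> borel_measurable (config_space M N)"
  "integrable (config_space M N) (\<lambda>x. (\<psi> \<theta> x)\<^sup>2)"
proof -
  have "D \<subseteq> L2_fun (config_space M N)" "H ` D \<subseteq> L2_fun (config_space M N)"
    using self_adjoint unfolding self_adjoint_operator_def densely_defined_operator_def by auto
  then show "\<psi> \<theta> \<in> borel_measurable (config_space M N)"
    "H (\<psi> \<theta>) \<in> borel_measurable (config_space M N)"
    "integrable (config_space M N) (\<lambda>x. (\<psi> \<theta> x)\<^sup>2)"
    using in_domain[of \<theta>] by (auto simp: L2_fun_def)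
qed

lemma prob_space_born_distribution: "prob_space (born_distribution (config_space M N) \<psi> \<theta>)"
proof -
  let ?Q = "config_space M N"
  let ?Z = "\<integral>y. \<bar>\<psi> \<theta> y\<bar>\<^sup>2 \<partial>?Q"
  note [measurable] = wavefunction_L2(1)[of \<theta>]
  have int: "integrable ?Q (\<lambda>x. \<bar>\<psi> \<theta> x\<bar>\<^sup>2)" using wavefunction_L2(3) by simp
  \<comment> \<open>The integral of a nonnegative function vanishes only if the function is zero
    almost everywhere, which \<open>nonzero\<close> excludes.\<close>
  have "?Z \<noteq> 0"
    using nonzero[of \<theta>] integral_nonneg_eq_0_iff_AE[OF int] by auto
  then have Z: "?Z > 0" by (simp add: order_less_le)
  have "(\<integral>\<^sup>+x. ennreal (\<bar>\<psi> \<theta> x\<bar>\<^sup>2 / ?Z) \<partial>?Q) = ennreal (\<integral>x. \<bar>\<psi> \<theta> x\<bar>\<^sup>2 / ?Z \<partial>?Q)"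
    using int Z by (intro nn_integral_eq_integral) auto
  also have "\<dots> = 1" using Z by simp
  finally show ?thesis
    unfolding born_distribution_def
    by (intro prob_spaceI) (simp add: emeasure_density cong: nn_integral_cong)
qed

lemma measurable_born_distribution:
  "measurable (born_distribution (config_space M N) \<psi> \<theta>) A = measurable (config_space M N) A"
  by (rule measurable_cong_sets) (auto simp: born_distribution_def)

lemma local_energy_measurable: "local_energy H \<psi> \<theta> \<in> borel_measurable (config_space M N)"
  using wavefunction_L2[of \<theta>] unfolding local_energy_def[abs_def] by measurable

lemma gderiv_energy:
  "GDERIV (energy (config_space M N) H \<psi>) \<theta> :> energy_grad (config_space M N) H \<psi> \<theta>"
  unfolding energy_grad_def by (rule gderiv_gradient[OF energy_differentiable])

text \<open>This supplies the lower bound on the energy under which the Lyapunov sum telescopes to a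
  finite limit. The energy is a mean of local energies, so their first absolute moment controls
  it.\<close>

lemma abs_energy_le:
  assumes "integrable (born_distribution (config_space M N) \<psi> \<theta>) (\<lambda>x. local_energy H \<psi> \<theta> x ^ 4)"
    and "(\<integral>x. local_energy H \<psi> \<theta> x ^ 4 \<partial>born_distribution (config_space M N) \<psi> \<theta>) \<le> c"
  shows "\<bar>energy (config_space M N) H \<psi> \<theta>\<bar> \<le> 1 + c"
proof -
  interpret P: prob_space "born_distribution (config_space M N) \<psi> \<theta>"
    by (rule prob_space_born_distribution)
  have "local_energy H \<psi> \<theta> \<in> borel_measurable (born_distribution (config_space M N) \<psi> \<theta>)"
    by (simp add: measurable_born_distribution local_energy_measurable)
  from P.moments_le_fourth_moment(2)[OF this, of c 1]
  have "(\<integral>x. \<bar>local_energy H \<psi> \<theta> x\<bar> \<partial>born_distribution (config_space M N) \<psi> \<theta>) \<le> 1 + c"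
    using assms by simp
  then show ?thesis
    unfolding energy_eq_expectation by (rule order_trans[OF integral_abs_bound])
qed

text \<open>The bound depends on the parameters only through \<open>c\<close>, hence is uniform
  along the iteration once \<open>c\<close> is a common moment bound.\<close>

lemma SR_matrix_bounds:
  assumes "integrable (born_distribution (config_space M N) \<psi> \<theta>) (\<lambda>x. norm (grad_log \<psi> \<theta> x) ^ 4)"
    and "(\<integral>x. norm (grad_log \<psi> \<theta> x) ^ 4 \<partial>born_distribution (config_space M N) \<psi> \<theta>) \<le> c"
  shows "v \<bullet> (SR_matrix (config_space M N) \<psi> \<theta> *v v) \<ge> 0"
    and "norm (SR_matrix (config_space M N) \<psi> \<theta> *v v) \<le> (2 * (1 + c) + 2 * (1 + c)\<^sup>2) * norm v"
proof -
  let ?P = "born_distribution (config_space M N) \<psi> \<theta>"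
  interpret P: prob_space ?P by (rule prob_space_born_distribution)
  have G: "grad_log \<psi> \<theta> \<in> borel_measurable ?P"
    by (simp add: measurable_born_distribution grad_log_measurable)
  have O: "centered_grad_log (config_space M N) \<psi> \<theta> \<in> borel_measurable ?P"
    unfolding centered_grad_log_def[abs_def] using G by measurable
  note m = second_moment_matrix[OF O,
      OF P.centered_second_moment_le[OF G assms, folded centered_grad_log_def],
      folded SR_matrix_def]
  show "v \<bullet> (SR_matrix (config_space M N) \<psi> \<theta> *v v) \<ge> 0"
    "norm (SR_matrix (config_space M N) \<psi> \<theta> *v v) \<le> (2 * (1 + c) + 2 * (1 + c)\<^sup>2) * norm v"
    by (rule m)+
qed

end

section \<open>Application to the SPRING iteration\<close>

theorem theorem3p1:
  fixes M :: "'a measure" and N :: nat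
    and D :: "((nat \<Rightarrow> 'a) \<Rightarrow> real) set"
    and H :: "((nat \<Rightarrow> 'a) \<Rightarrow> real) \<Rightarrow> ((nat \<Rightarrow> 'a) \<Rightarrow> real)"
    and \<psi> :: "real^'p \<Rightarrow> (nat \<Rightarrow> 'a) \<Rightarrow> real"
    and lam \<mu> C\<^sub>m C\<^sub>g :: real
    and \<eta> :: "nat \<Rightarrow> real"
    and \<theta> \<Delta>\<theta> :: "nat \<Rightarrow> real^'p"
    and \<Delta>\<theta>_init :: "real^'p"
  assumes setting: "vmc_setting M N D H \<psi>"
    and "lam > 0" and "0 \<le> \<mu>" and "\<mu> < 1"
    and "C\<^sub>m > 0"
    and moment_grad_log:
      "\<And>\<alpha>. integrable (born_distribution (config_space M N) \<psi> \<alpha>)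
              (\<lambda>x. norm (grad_log \<psi> \<alpha> x) ^ 4)"
      "\<And>\<alpha>. (\<integral>x. norm (grad_log \<psi> \<alpha> x) ^ 4
               \<partial>born_distribution (config_space M N) \<psi> \<alpha>) \<le> C\<^sub>m"
    and moment_local_energy:
      "\<And>\<alpha>. integrable (born_distribution (config_space M N) \<psi> \<alpha>)
              (\<lambda>x. local_energy H \<psi> \<alpha> x ^ 4)"
      "\<And>\<alpha>. (\<integral>x. local_energy H \<psi> \<alpha> x ^ 4
               \<partial>born_distribution (config_space M N) \<psi> \<alpha>) \<le> C\<^sub>m"
    and "C\<^sub>g > 0"
    and grad_lipschitz:
      "\<And>\<alpha> \<beta>. norm (energy_grad (config_space M N) H \<psi> \<alpha> - energy_grad (config_space M N) H \<psi> \<beta>)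
                \<le> C\<^sub>g * norm (\<alpha> - \<beta>)"
    and step_sizes: "\<And>k. k \<ge> 1 \<Longrightarrow> 0 < \<eta> k \<and> \<eta> k \<le> \<eta> (k - 1)"
      "0 < \<eta> 0" "\<eta> 0 \<le> 2 * lam * (1 - \<mu>) / C\<^sub>g"
    and direction: "\<And>k. \<Delta>\<theta> k =
      matrix_inv (lam *\<^sub>R mat 1 + SR_matrix (config_space M N) \<psi> (\<theta> k)) *v
        ((lam * \<mu>) *\<^sub>R (if k = 0 then \<Delta>\<theta>_init else \<Delta>\<theta> (k - 1))
          - (1 / 2) *\<^sub>R energy_grad (config_space M N) H \<psi> (\<theta> k))"
    and update: "\<And>k. \<theta> (Suc k) = \<theta> k + \<eta> k *\<^sub>R \<Delta>\<theta> k"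
  shows "\<exists>C>0. \<forall>K\<ge>1. (\<Sum>k=1..K. \<eta> k * (norm (energy_grad (config_space M N) H \<psi> (\<theta> k)))\<^sup>2) \<le> C"
proof -
  interpret vmc_setting M N D H \<psi> by (rule setting)
  let ?L = "energy (config_space M N) H \<psi>" and ?g = "energy_grad (config_space M N) H \<psi>"
  let ?S = "\<lambda>k. SR_matrix (config_space M N) \<psi> (\<theta> k)"
  have psd: "v \<bullet> (?S k *v v) \<ge> 0" for k v
    by (rule SR_matrix_bounds(1)[OF moment_grad_log])
  \<comment> \<open>At a successor index the conditional in \<open>direction\<close> selects the
    previous iterate rather than the initial vector.\<close>
  have eq: "lam *\<^sub>R \<Delta>\<theta> (Suc k) + ?S (Suc k) *v \<Delta>\<theta> (Suc k) =
      (lam * \<mu>) *\<^sub>R \<Delta>\<theta> k - (1 / 2) *\<^sub>R ?g (\<theta> (Suc k))" for k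
    using direction[of "Suc k"] by (intro matrix_inv_shifted_mult[OF \<open>lam > 0\<close> psd]) simp
  have lower: "- (1 + C\<^sub>m) \<le> ?L \<alpha>" for \<alpha>
    using abs_energy_le[OF moment_local_energy, of \<alpha>] by linarith
  have pos: "0 < \<eta> k" for k using step_sizes(1)[of k] step_sizes(2) by (cases k) auto
  have dec: "\<eta> (Suc k) \<le> \<eta> k" for k using step_sizes(1)[of "Suc k"] by simp
  \<comment> \<open>Here \<open>u k\<close> becomes \<open>?S k *v \<Delta>\<theta> k\<close>, the
    lower bound \<open>m\<close> becomes \<open>- (1 + C\<^sub>m)\<close>, and \<open>B\<close> is
    the constant of \<open>SR_matrix_bounds\<close> at \<open>C\<^sub>m\<close>.\<close>
  have "\<exists>C>0. \<forall>K. (\<Sum>k=1..K. \<eta> k * (norm (?g (\<theta> k)))\<^sup>2) \<le> C"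
    by (rule damped_momentum_gradient_sum_bounded[OF gderiv_energy grad_lipschitz lower
          \<open>lam > 0\<close> \<open>0 \<le> \<mu>\<close> \<open>\<mu> < 1\<close> \<open>C\<^sub>g > 0\<close> pos dec step_sizes(3) eq psd
          SR_matrix_bounds(2)[OF moment_grad_log] update])
  then show ?thesis by blast
qed

end
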